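(* Let $\theta=\phi(D)$ be a delta operator with poweroids $x^{\{n\}}$, and let $\eta=\phi^{-1}(D)$. Then for every integer $n\ge1$, $$x^{\{n\}}=\sum_{\nu=1}^n x^\nu\,\frac{D^\nu 0^{\{n\}}}{\nu!}=\sum_{\nu=1}^n x^\nu\,\frac{\eta^\nu 0^n}{\nu!}=e^{xD}\,0^{\{n\}}=e^{x\eta}\,0^n .$$
   Context: Work with polynomials in $x$ (real or complex coefficients); $D$ is differentiation. A delta operator is $\theta=\phi(D)$, where $\phi(t)=\sum_{\nu\ge1}k_\nu t^\nu$ is a formal power series with $k_1=1$; $\phi^{-1}$ is its compositional inverse. The poweroids $x^{\{n\}}$, $n=0,1,2,\dots$, of $\theta$ are the unique polynomials with $x^{\{0\}}=1$, $\theta x^{\{n\}}=n\,x^{\{n-1\}}$ for $n\ge1$, and $x^{\{n\}}|_{x=0}=0$ for $n\ge1$. For a formal power series $f$, $f(D)\,0^{\{n\}}=\big(f(D_z)z^{\{n\}}\big)|_{z=0}$ and $f(D)\,0^n=\big(f(D_z)z^{n}\big)|_{z=0}$, where $D_z=d/dz$; in particular $\eta^\nu 0^n=\big(\phi^{-1}(D_z)^\nu z^n\big)|_{z=0}$. In $e^{xD}0^{\{n\}}$ and $e^{x\eta}0^n$ the operators $D,\eta$ act on the variable $z$ (later set to $0$), $x$ is treated as a parameter, and the exponentials are expanded as power series. *)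

theory Defs
  imports
    "HOL-Computational_Algebra.Computational_Algebra"
    "HOL-Library.Groups_Big_Fun"
begin

unbundle fps_syntax

text \<open>
  The operator \<open>f(T) = (\<Sum>k. f\<^sub>k T\<^sup>k)\<close>.  It is meant for operators \<open>T\<close>
  that lower the degree, such as \<open>pderiv\<close> and power series in \<open>pderiv\<close> with zero constant term:
  then only finitely many terms are nonzero for each \<open>p\<close> (\<open>Sum_any\<close> is \<open>0\<close> otherwise).
\<close>
definition series_op :: "'a::field_char_0 fps \<Rightarrow> ('a poly \<Rightarrow> 'a poly) \<Rightarrow> 'a poly \<Rightarrow> 'a poly"
  where "series_op f T p = Sum_any (\<lambda>k. smult (f $ k) ((T ^^ k) p))"

definition is_delta_series :: "'a::field_char_0 fps \<Rightarrow> bool"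
  where "is_delta_series \<phi> \<longleftrightarrow> \<phi> $ 0 = 0 \<and> \<phi> $ 1 = 1"

definition is_poweroid_seq :: "('a::field_char_0 poly \<Rightarrow> 'a poly) \<Rightarrow> (nat \<Rightarrow> 'a poly) \<Rightarrow> bool"
  where "is_poweroid_seq \<theta> p \<longleftrightarrow>
    p 0 = 1 \<and>
    (\<forall>n\<ge>1. \<theta> (p n) = smult (of_nat n) (p (n - 1))) \<and>
    (\<forall>n\<ge>1. poly (p n) 0 = 0)"

text \<open>Well defined for delta operators by \<open>ex1_poweroid_seq\<close> below.\<close>
definition poweroid :: "('a::field_char_0 poly \<Rightarrow> 'a poly) \<Rightarrow> nat \<Rightarrow> 'a poly"
  where "poweroid \<theta> = (THE p. is_poweroid_seq \<theta> p)"

lemma series_op_pderiv: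
  assumes "degree p \<le> N"
  shows "series_op f pderiv p = (\<Sum>k\<le>N. smult (f $ k) ((pderiv ^^ k) p))"
  unfolding series_op_def
proof (rule Sum_any.expand_superset)
  have "(pderiv ^^ k) p = 0" if "k > N" for k
  proof (rule poly_eqI)
    fix j
    have "coeff p (j + k) = 0"
      using that assms by (intro coeff_eq_0) auto
    then show "coeff ((pderiv ^^ k) p) j = coeff 0 j"
      by (simp add: coeff_higher_pderiv)
  qed
  then show "{k. smult (f $ k) ((pderiv ^^ k) p) \<noteq> 0} \<subseteq> {..N}"
    by (auto simp: not_le[symmetric])
qed simp

lemma series_op_pderiv_add:
  "series_op f pderiv (p + q) = series_op f pderiv p + series_op f pderiv q"
proof -
  let ?N = "max (degree p) (degree q)"
  have "degree (p + q) \<le> ?N" by (rule degree_add_le_max)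
  then show ?thesis
    by (simp add: series_op_pderiv[of _ ?N] higher_pderiv_add smult_add_right sum.distrib)
qed

lemma series_op_pderiv_diff:
  "series_op f pderiv (p - q) = series_op f pderiv p - series_op f pderiv q"
  using series_op_pderiv_add[of f "p - q" q] by simp

lemma coeff_delta_op:
  assumes "is_delta_series \<phi>" and "degree p \<le> Suc m" and "m \<le> j"
  shows "coeff (series_op \<phi> pderiv p) j = of_nat (Suc j) * coeff p (Suc j)"
proof -
  have z: "coeff p (j + k) = 0" if "k \<ge> 2" for k
    using that assms by (intro coeff_eq_0) auto
  have "coeff (series_op \<phi> pderiv p) j
      = (\<Sum>k\<le>Suc m. \<phi> $ k * (pochhammer (of_nat (Suc j)) k * coeff p (j + k)))"
    by (simp only: series_op_pderiv[OF assms(2)] coeff_sum coeff_smult coeff_higher_pderiv)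
  also have "\<dots> = (\<Sum>k\<in>{1}. \<phi> $ k * (pochhammer (of_nat (Suc j)) k * coeff p (j + k)))"
  proof (rule sum.mono_neutral_right)
    show "\<forall>k\<in>{..Suc m} - {1}. \<phi> $ k * (pochhammer (of_nat (Suc j)) k * coeff p (j + k)) = 0"
    proof
      fix k assume "k \<in> {..Suc m} - {1}"
      then have "k = 0 \<or> k \<ge> 2" by auto
      then show "\<phi> $ k * (pochhammer (of_nat (Suc j)) k * coeff p (j + k)) = 0"
        using z assms(1) by (auto simp: is_delta_series_def)
    qed
  qed auto
  finally show ?thesis
    using assms(1) by (simp add: is_delta_series_def)
qed

lemma delta_op_inj:
  assumes "is_delta_series \<phi>" "series_op \<phi> pderiv q = 0" "poly q 0 = 0"
  shows "q = 0"
proof (cases "degree q")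
  case 0
  then show ?thesis using assms(3) by (auto elim: degree_eq_zeroE)
next
  case (Suc m)
  then have "of_nat (Suc m) * coeff q (Suc m) = 0"
    using coeff_delta_op[OF assms(1), of q m m] assms(2) by simp
  then have "lead_coeff q = 0"
    using Suc by (metis mult_eq_0_iff of_nat_eq_0_iff nat.distinct(1))
  then show ?thesis by simp
qed

lemma delta_op_surj:
  assumes "is_delta_series \<phi>" and "\<forall>j\<ge>N. coeff r j = 0"
  shows "\<exists>q. series_op \<phi> pderiv q = r \<and> poly q 0 = 0"
  using assms(2)
proof (induction N arbitrary: r)
  case 0
  then have "r = 0" by (simp add: poly_eq_iff)
  then show ?case by (intro exI[of _ 0]) (simp add: series_op_pderiv[of _ 0])
next
  case (Suc N)
  define q0 where "q0 = monom (coeff r N / of_nat (Suc N)) (Suc N)"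
  have c: "coeff (series_op \<phi> pderiv q0) j = of_nat (Suc j) * coeff q0 (Suc j)" if "j \<ge> N" for j
    using that by (intro coeff_delta_op[OF assms(1)]) (auto simp: q0_def intro: degree_monom_le)
  have "coeff (r - series_op \<phi> pderiv q0) j = 0" if "j \<ge> N" for j
    using c[OF that] Suc.prems that
    by (cases "j = N") (auto simp: q0_def simp del: of_nat_Suc)
  then obtain q1 where "series_op \<phi> pderiv q1 = r - series_op \<phi> pderiv q0" "poly q1 0 = 0"
    using Suc.IH by blast
  then show ?case
    by (intro exI[of _ "q0 + q1"]) (simp add: series_op_pderiv_add q0_def poly_monom)
qed

lemma ex1_poweroid_seq:
  assumes "is_delta_series \<phi>"
  shows "\<exists>!p. is_poweroid_seq (series_op \<phi> pderiv) p"
proof (rule ex_ex1I)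
  let ?\<theta> = "series_op \<phi> pderiv"
  have "\<exists>q. ?\<theta> q = r \<and> poly q 0 = 0" for r
    by (rule delta_op_surj[OF assms, of "Suc (degree r)"]) (auto intro: coeff_eq_0)
  then obtain I where I: "\<And>r. ?\<theta> (I r) = r" "\<And>r. poly (I r) 0 = 0"
    by metis
  define p where "p = rec_nat 1 (\<lambda>n q. I (smult (of_nat (Suc n)) q))"
  have "p 0 = 1" "\<And>n. p (Suc n) = I (smult (of_nat (Suc n)) (p n))"
    by (simp_all add: p_def)
  then have "?\<theta> (p n) = smult (of_nat n) (p (n - 1))" "poly (p n) 0 = 0" if "n \<ge> 1" for n
    using that I by (cases n; simp)+
  with \<open>p 0 = 1\<close> have pp: "is_poweroid_seq ?\<theta> p"
    by (simp add: is_poweroid_seq_def)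
  show "\<exists>p. is_poweroid_seq ?\<theta> p" using pp by blast
next
  fix p q
  assume p: "is_poweroid_seq (series_op \<phi> pderiv) p" and q: "is_poweroid_seq (series_op \<phi> pderiv) q"
  show "p = q"
  proof
    fix n show "p n = q n"
    proof (induction n)
      case 0
      then show ?case using p q by (simp add: is_poweroid_seq_def)
    next
      case (Suc n)
      have step: "series_op \<phi> pderiv (f (Suc n)) = smult (of_nat (Suc n)) (f n)"
        and zero: "poly (f (Suc n)) 0 = 0"
        if "is_poweroid_seq (series_op \<phi> pderiv) f" for f
        proof -
        have "\<forall>m\<ge>1. series_op \<phi> pderiv (f m) = smult (of_nat m) (f (m - 1))"
          and "\<forall>m\<ge>1. poly (f m) 0 = 0"
          using that unfolding is_poweroid_seq_def by blast+
        from this[THEN spec, of "Suc n"]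
        show "series_op \<phi> pderiv (f (Suc n)) = smult (of_nat (Suc n)) (f n)"
          "poly (f (Suc n)) 0 = 0"
          by (simp_all del: of_nat_Suc)
      qed
      have "series_op \<phi> pderiv (p (Suc n) - q (Suc n)) = 0"
        by (simp only: series_op_pderiv_diff step[OF p] step[OF q] Suc.IH diff_self)
      moreover have "poly (p (Suc n) - q (Suc n)) 0 = 0"
        by (simp only: poly_diff zero[OF p] zero[OF q] diff_self)
      ultimately have "p (Suc n) - q (Suc n) = 0"
        by (rule delta_op_inj[OF assms])
      then show ?case by simp
    qed
  qed
qed

end

theory Submission
  imports Defs
begin

text \<open>
  Put \<open>\<psi> = \<phi>\<inverse>\<close>.  Since \<open>\<eta>\<^sup>\<nu> = \<psi>\<^sup>\<nu>(D)\<close>, evaluating \<open>\<eta>\<^sup>\<nu> z\<^sup>n\<close> at \<open>0\<close> extracts \<open>n!\<close> times the coefficient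
  of \<open>t\<^sup>n\<close> in \<open>\<psi>\<^sup>\<nu>\<close>.  So the second expansion says that the coefficient of \<open>x\<^sup>\<nu>\<close> in the \<open>n\<close>th poweroid
  is \<open>n!/\<nu>!\<close> times the coefficient of \<open>t\<^sup>n\<close> in \<open>\<psi>\<^sup>\<nu>\<close>.  The polynomials with these coefficients satisfy
  the defining recursion because \<open>\<psi>\<^sup>j \<cdot> \<phi>(\<psi>(t)) = t \<psi>\<^sup>j\<close>, and poweroids are unique.  The other
  expansions are Taylor's formula at \<open>0\<close>.
\<close>

lemma higher_pderiv_eq_0:
  fixes p :: "'a::field_char_0 poly"
  assumes "degree p < k"
  shows "(pderiv ^^ k) p = 0"
  using assms by (intro poly_eqI) (simp add: coeff_higher_pderiv coeff_eq_0)

lemma higher_pderiv_sum_smult: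
  fixes p :: "'b \<Rightarrow> 'a::field_char_0 poly"
  shows "(pderiv ^^ k) (\<Sum>i\<in>A. smult (c i) (p i)) = (\<Sum>i\<in>A. smult (c i) ((pderiv ^^ k) (p i)))"
  by (rule poly_eqI) (simp add: coeff_higher_pderiv coeff_sum sum_distrib_left mult.left_commute)

lemma smult_sum_right: "smult c (\<Sum>i\<in>A. p i) = (\<Sum>i\<in>A. smult c (p i))"
  by (rule poly_eqI) (simp add: coeff_sum sum_distrib_left)

lemma poly_higher_pderiv_0:
  fixes p :: "'a::field_char_0 poly"
  shows "poly ((pderiv ^^ k) p) 0 = fact k * coeff p k"
  by (simp add: poly_0_coeff_0 coeff_higher_pderiv pochhammer_fact)

text \<open>The rising factorial of \<open>Suc j\<close> is written as a quotient of factorials, so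
  that it cancels against the factor \<open>fact n / fact j\<close> in the coefficients of the
  poweroids.\<close>

lemma coeff_series_op_pderiv:
  fixes p :: "'a::field_char_0 poly"
  assumes "degree p \<le> N"
  shows "coeff (series_op f pderiv p) j
       = (\<Sum>k\<le>N. f $ k * (fact (j + k) / fact j * coeff p (j + k)))"
proof -
  have "pochhammer (of_nat (Suc j)) k = (fact (j + k) / fact j :: 'a)" for k
    using pochhammer_product'[of "1::'a" j k]
    by (simp add: pochhammer_fact[symmetric] add.commute)
  then show ?thesis
    by (simp add: series_op_pderiv[OF assms] coeff_sum coeff_higher_pderiv del: of_nat_Suc)
qed

lemma series_op_pderiv_mult:
  fixes p :: "'a::field_char_0 poly"
  shows "series_op f pderiv (series_op g pderiv p) = series_op (f * g) pderiv p"
proof -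
  define N where "N = degree p"
  let ?h = "\<lambda>k l. smult (f $ k * g $ l) ((pderiv ^^ (k + l)) p)"
  have deg: "degree (series_op g pderiv p) \<le> N"
    by (rule degree_le) (simp add: coeff_series_op_pderiv[of p N] N_def coeff_eq_0)
  have "series_op f pderiv (series_op g pderiv p) = (\<Sum>k\<le>N. \<Sum>l\<le>N. ?h k l)"
    by (subst series_op_pderiv[OF deg])
       (simp add: series_op_pderiv[of p N g] N_def higher_pderiv_sum_smult smult_sum_right funpow_add)
  also have "\<dots> = (\<Sum>(k,l)\<in>{..N} \<times> {..N}. ?h k l)"
    by (simp add: sum.cartesian_product)
  \<comment> \<open>Derivatives of order above the degree vanish, so the square shrinks to a
    triangle, whose diagonals give the Cauchy product.\<close>
  also have "\<dots> = (\<Sum>(k,l)\<in>{(k,l). k + l \<le> N}. ?h k l)"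
    by (rule sum.mono_neutral_right) (auto simp: N_def not_le intro!: higher_pderiv_eq_0)
  also have "\<dots> = (\<Sum>m\<le>N. \<Sum>k\<le>m. ?h k (m - k))"
    by (rule sum.triangle_reindex_eq)
  also have "\<dots> = (\<Sum>m\<le>N. smult ((f * g) $ m) ((pderiv ^^ m) p))"
    by (simp add: fps_mult_nth smult_sum atMost_atLeast0)
  also have "\<dots> = series_op (f * g) pderiv p"
    unfolding N_def by (rule series_op_pderiv[symmetric]) simp
  finally show ?thesis .
qed

lemma funpow_series_op_pderiv:
  fixes p :: "'a::field_char_0 poly"
  shows "(series_op f pderiv ^^ k) p = series_op (f ^ k) pderiv p"
proof (induction k)
  case 0
  have "series_op 1 pderiv p = (\<Sum>k\<le>degree p. if k = 0 then (pderiv ^^ k) p else 0)"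
    unfolding series_op_pderiv[OF order_refl] by (intro sum.cong) auto
  then show ?case by simp
next
  case (Suc k)
  then show ?case by (simp add: series_op_pderiv_mult)
qed

text \<open>At 0 only the derivative of order exactly \<open>n\<close> of \<open>z^n\<close>
  survives, with value \<open>n!\<close>.\<close>

lemma poly_series_op_monom_0:
  "poly (series_op f pderiv (monom (1::'a::field_char_0) n)) 0 = fact n * f $ n"
  unfolding poly_0_coeff_0
  by (subst coeff_series_op_pderiv[of _ n]) (simp_all add: degree_monom_le mult_delta_right)

lemma series_op_monom_eq_0:
  assumes "\<And>k. k \<le> n \<Longrightarrow> f $ k = 0"
  shows "series_op f pderiv (monom (1::'a::field_char_0) n) = 0"
  by (simp add: series_op_pderiv[of _ n] degree_monom_le assms)

lemma coeff_poweroid: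
  fixes \<phi> :: "'a::field_char_0 fps"
  assumes "is_delta_series \<phi>"
  shows "coeff (poweroid (series_op \<phi> pderiv) n) j = fact n / fact j * (fps_inv \<phi> ^ j) $ n"
proof -
  define \<psi> where "\<psi> = fps_inv \<phi>"
  define q :: "nat \<Rightarrow> 'a poly"
    where "q n = (\<Sum>j\<le>n. monom (fact n / fact j * (\<psi> ^ j) $ n) j)" for n
  have \<psi>0: "\<psi> $ 0 = 0" by (simp add: \<psi>_def fps_inv_def)
  \<comment> \<open>Valid for all \<open>j\<close>, although \<open>q n\<close> stops at
    \<open>n\<close>: since \<open>\<psi>\<close> has no constant term, \<open>\<psi> ^ j\<close>
    starts at order \<open>j\<close> or later.\<close>
  have coeff_q: "coeff (q n) j = fact n / fact j * (\<psi> ^ j) $ n" for n j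
    using startsby_zero_power_prefix[OF \<psi>0] by (auto simp: q_def coeff_sum)
  have deg_q: "degree (q n) \<le> n" for n
    using startsby_zero_power_prefix[OF \<psi>0] by (intro degree_le) (auto simp: coeff_q)
  have inv: "\<phi> oo \<psi> = fps_X"
    using assms by (simp add: \<psi>_def is_delta_series_def fps_inv_right)
  have key: "(\<Sum>k\<le>n. \<phi> $ k * (\<psi> ^ (j + k)) $ n) = (fps_X * \<psi> ^ j) $ n" for n j
  proof -
    \<comment> \<open>Writing \<open>\<psi> ^ j\<close> as \<open>fps_X ^ j oo \<psi>\<close> turns
      the product into one composition, whose coefficients are explicit sums.\<close>
    have "fps_X * \<psi> ^ j = (\<phi> oo \<psi>) * (fps_X ^ j oo \<psi>)"
      by (simp add: inv fps_compose_power[OF \<psi>0, symmetric] fps_X_fps_compose_startby0[OF \<psi>0])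
    also have "\<dots> = (\<phi> * fps_X ^ j) oo \<psi>"
      by (simp add: fps_compose_mult_distrib[OF \<psi>0])
    also have "\<dots> $ n = (\<Sum>i\<le>n. (\<phi> * fps_X ^ j) $ i * (\<psi> ^ i) $ n)"
      by (simp add: fps_compose_nth atMost_atLeast0)
    \<comment> \<open>The added terms vanish because \<open>i > n\<close>; with the bound
      \<open>n + j\<close>, the shift \<open>i = j + k\<close> makes \<open>k\<close> run exactly up
      to \<open>n\<close>.\<close>
    also have "\<dots> = (\<Sum>i\<in>{..n + j}. (\<phi> * fps_X ^ j) $ i * (\<psi> ^ i) $ n)"
      using startsby_zero_power_prefix[OF \<psi>0] by (intro sum.mono_neutral_left) auto
    also have "\<dots> = (\<Sum>i\<in>{j..n + j}. \<phi> $ (i - j) * (\<psi> ^ i) $ n)"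
      by (rule sum.mono_neutral_cong_right) (auto simp: fps_X_power_mult_right_nth)
    also have "\<dots> = (\<Sum>k\<le>n. \<phi> $ k * (\<psi> ^ (j + k)) $ n)"
      by (rule sum.reindex_bij_witness[of _ "\<lambda>k. j + k" "\<lambda>i. i - j"]) auto
    finally show ?thesis by simp
  qed
  have "is_poweroid_seq (series_op \<phi> pderiv) q"
    unfolding is_poweroid_seq_def
  proof (intro conjI allI impI)
    show "q 0 = 1" by (simp add: q_def)
  next
    fix n :: nat assume n: "n \<ge> 1"
    show "poly (q n) 0 = 0" using n by (simp add: poly_0_coeff_0 coeff_q)
    show "series_op \<phi> pderiv (q n) = smult (of_nat n) (q (n - 1))"
    proof (rule poly_eqI)
      fix j
      have "coeff (series_op \<phi> pderiv (q n)) j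
          = (\<Sum>k\<le>n. fact n / fact j * (\<phi> $ k * (\<psi> ^ (j + k)) $ n))"
        by (simp add: coeff_series_op_pderiv[OF deg_q] coeff_q mult_ac)
      also have "\<dots> = fact n / fact j * (fps_X * \<psi> ^ j) $ n"
        by (simp only: sum_distrib_left[symmetric] key)
      also have "\<dots> = coeff (smult (of_nat n) (q (n - 1))) j"
        using n by (simp add: coeff_q fact_reduce)
      finally show "coeff (series_op \<phi> pderiv (q n)) j = \<dots>" .
    qed
  qed
  then have "poweroid (series_op \<phi> pderiv) = q"
    unfolding poweroid_def by (rule the1_equality[OF ex1_poweroid_seq[OF assms]])
  then show ?thesis by (simp add: coeff_q \<psi>_def)
qed

theorem mainTheorem3:
  fixes \<phi> :: "'a::field_char_0 fps"
    and \<theta> \<eta> :: "'a poly \<Rightarrow> 'a poly"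
    and x :: 'a and n :: nat
  assumes "is_delta_series \<phi>"
    and "\<theta> = series_op \<phi> pderiv"
    and "\<eta> = series_op (fps_inv \<phi>) pderiv"
    and "n \<ge> 1"
  shows "poly (poweroid \<theta> n) x
          = (\<Sum>\<nu>=1..n. x ^ \<nu> * (poly ((pderiv ^^ \<nu>) (poweroid \<theta> n)) 0 / fact \<nu>))
       \<and> poly (poweroid \<theta> n) x
          = (\<Sum>\<nu>=1..n. x ^ \<nu> * (poly ((\<eta> ^^ \<nu>) (monom 1 n)) 0 / fact \<nu>))
       \<and> poly (poweroid \<theta> n) x
          = poly (series_op (fps_exp x) pderiv (poweroid \<theta> n)) 0
       \<and> poly (poweroid \<theta> n) x
          = poly (series_op (fps_exp x) \<eta> (monom 1 n)) 0"
proof -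
  define \<psi> where "\<psi> = fps_inv \<phi>"
  let ?p = "poweroid \<theta> n"
  have \<psi>0: "\<psi> $ 0 = 0" by (simp add: \<psi>_def fps_inv_def)
  have coeff_p: "coeff ?p j = fact n / fact j * (\<psi> ^ j) $ n" for j
    using coeff_poweroid[OF assms(1)] assms(2) by (simp add: \<psi>_def)
  have deg: "degree ?p \<le> n"
    using startsby_zero_power_prefix[OF \<psi>0] by (intro degree_le) (auto simp: coeff_p)
  \<comment> \<open>This is where \<open>n \<ge> 1\<close> enters: it lets the sums start at
    \<open>\<nu> = 1\<close>.\<close>
  have p0: "coeff ?p 0 = 0" using assms(4) by (simp add: coeff_p)
  have \<eta>: "(\<eta> ^^ k) (monom 1 n) = series_op (\<psi> ^ k) pderiv (monom 1 n)" for k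
    by (simp add: assms(3) \<psi>_def funpow_series_op_pderiv)
  have D0: "poly ((pderiv ^^ k) ?p) 0 / fact k = coeff ?p k" for k
    by (simp add: poly_higher_pderiv_0)
  have \<eta>0: "poly ((\<eta> ^^ k) (monom 1 n)) 0 / fact k = coeff ?p k" for k
    by (simp add: \<eta> poly_series_op_monom_0 coeff_p)
  have full: "poly ?p x = (\<Sum>k\<le>n. x ^ k * coeff ?p k)"
    by (subst poly_as_sum_of_monoms'[OF deg, symmetric]) (simp add: poly_sum poly_monom mult.commute)
  have "{..n} = insert 0 {1..n}" by auto
  then have expand: "poly ?p x = (\<Sum>k=1..n. x ^ k * coeff ?p k)"
    by (simp add: full p0)
  have "poly (series_op (fps_exp x) pderiv ?p) 0 = (\<Sum>k\<le>n. x ^ k * coeff ?p k)"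
    by (simp add: series_op_pderiv[OF deg] poly_sum D0[symmetric])
  moreover have "poly (series_op (fps_exp x) \<eta> (monom 1 n)) 0 = (\<Sum>k\<le>n. x ^ k * coeff ?p k)"
  proof -
    \<comment> \<open>\<open>\<psi> ^ k\<close> has no terms of order up to \<open>n\<close> here.
      The support in \<open>Sum_any\<close> is therefore finite, so the default value 0 for infinite
      support does not arise.\<close>
    have "(\<eta> ^^ k) (monom 1 n) = 0" if "k > n" for k
      unfolding \<eta> using that startsby_zero_power_prefix[OF \<psi>0]
      by (intro series_op_monom_eq_0) auto
    then have "{k. smult (fps_exp x $ k) ((\<eta> ^^ k) (monom 1 n)) \<noteq> 0} \<subseteq> {..n}"
      by (metis (mono_tags, lifting) atMost_iff linorder_not_le mem_Collect_eq smult_0_right subsetI)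
    then have "series_op (fps_exp x) \<eta> (monom 1 n)
        = (\<Sum>k\<le>n. smult (fps_exp x $ k) ((\<eta> ^^ k) (monom 1 n)))"
      unfolding series_op_def by (intro Sum_any.expand_superset) simp_all
    then show ?thesis by (simp add: poly_sum \<eta>0[symmetric])
  qed
  ultimately show ?thesis
    unfolding D0 \<eta>0 using full expand by metis
qed

end
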